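(* Let $H,E,G$, the graded mesh, the collocation points and the matrices ${\bf H}^n,{\bf B}^n$ be as in the context. For any $0<\alpha\le1$ there exists $k_\alpha>0$ such that, whenever $\Delta t:=\max_{1\le n\le N}\Delta t_n<k_\alpha$, the $2\times2$ matrix ${\bf H}^n-{\bf B}^n$ is non-singular for each $1\le n\le N$, provided the matrix ${\bf H}^n$ is non-singular (for each $1\le n\le N$). Consequently, under these conditions the discontinuous piecewise linear collocation scheme $$H(t_{n,j})\,\tilde w(t_{n,j})-\int_0^{t_{n,j}}E(t_{n,j},\tau)\,\tilde w(\tau)\,d\tau=G(t_{n,j}),\qquad j=1,2,\quad n=1,\dots,N,$$ has a unique solution $\tilde w\in S$.
   Context: Fix $T>0$ and $0<\alpha\le\gamma\le1$. The data are functions $h(x,t)$ and $g(x)$, for $0\le x\le1$, and $q(t)$ on $[0,T]$. Put $\lambda_i=2\pi i$ for $i\ge1$, $h_{1i}(t)=\int_0^1h(x,t)\sin(\lambda_ix)\,dx$, $g_{1i}=\int_0^1g(x)\sin(\lambda_ix)\,dx$, and $H(t)=\int_0^1h(x,t)\,dx$. The Mittag-Leffler function is $E_{\alpha,\beta}(z)=\sum_{k\ge0}z^k/\Gamma(\alpha k+\beta)$, and $\Theta_i^\mu(t)=t^{\mu-1}E_{\alpha,\mu}(-\lambda_i^2t^\alpha)$ for $\mu\in\{\alpha,\gamma\}$. For $0<\mu<1$, $I^\mu y(t)=\int_0^t\frac{(t-\tau)^{\mu-1}}{\Gamma(\mu)}y(\tau)\,d\tau$ is the Riemann-Liouville fractional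 integral ($I^0$ is the identity), $D^\mu y=\frac{d}{dt}I^{1-\mu}y$ (and $D^1=\frac{d}{dt}$), and $D^{\alpha,\gamma}y(t)=D^\alpha\Big(y(t)-\frac{(I^{1-\gamma}y)(0)}{\Gamma(\gamma)}t^{\gamma-1}\Big)$. The kernel and right-hand side are $$E(t,\tau)=4\sum_{i=1}^\infty\lambda_ih_{1i}(\tau)\,\Theta_i^\alpha(t-\tau)=(t-\tau)^{\alpha-1}\tilde E(t,\tau),\qquad \tilde E(t,\tau)=4\sum_{i=1}^\infty\lambda_ih_{1i}(\tau)E_{\alpha,\alpha}(-\lambda_i^2(t-\tau)^\alpha),$$ $$G(t)=D^{\alpha,\gamma}q(t)+4\sum_{i=1}^\infty\lambda_ig_{1i}\Theta_i^\gamma(t).$$ Assumptions on the data: $g$, $h$ and $q$ are sufficiently regular that the series converge, that $\tilde E$ is bounded and continuous for $0\le\tau\le t\le T$ (for instance, $h$ has finitely many Fourier modes, or $|h_{1i}(\tau)|\le C\lambda_i^{-2-\epsilon}$ for some $\epsilon>0$), and that $G$ is continuous on $[\epsilon,T]$ for every $0<\epsilon<T$. Thus $E$ is weakly singular of order $\alpha-1$. Mesh and scheme: let $\delta\ge1$, $t_n=(n/N)^\delta T$ for $0\le n\le N$, $I_n=(t_{n-1},t_n]$, $\Delta t_n=t_n-t_{n-1}$. Fix $0<\xi_1<\xi_2<1$ and let $t_{n,j}=t_{n-1}+\xi_j\Delta t_n$ for $j=1,2$, $1\le n\le N$, be the collocation points. $S$ is the finite-dimensional space of functions that are linear polynomials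 (degree at most $1$) on each $I_n$, with no continuity required at the nodes. The local Lagrange basis functions on $I_n$ are $L_{n,1}(t)=\frac{t_{n,2}-t}{t_{n,2}-t_{n,1}}$ and $L_{n,2}(t)=\frac{t-t_{n,1}}{t_{n,2}-t_{n,1}}$. For $s,j\in\{1,2\}$ put $a_{n,s}(t_{n,j})=\int_{t_{n-1}}^{t_{n,j}}E(t_{n,j},\tau)L_{n,s}(\tau)\,d\tau$, and $${\bf H}^n=\begin{bmatrix}H(t_{n,1})&0\\0&H(t_{n,2})\end{bmatrix},\qquad {\bf B}^n=\begin{bmatrix}a_{n,1}(t_{n,1})&a_{n,2}(t_{n,1})\\{a_{n,1}(t_{n,2})}&a_{n,2}(t_{n,2})\end{bmatrix}.$$ On each $I_n$ the scheme amounts to a $2\times2$ linear system with matrix ${\bf H}^n-{\bf B}^n$ for the unknowns $\tilde w(t_{n,1}),\tilde w(t_{n,2})$.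
   Formalization: The formal theorem also assumes that the inverses of the matrices H^n are bounded in norm by some μ, and the threshold k may depend on μ; with non-singularity of H^n alone the claim fails, e.g. for H(t) = ∫_0^t E(t,τ)dτ, where w = 1 solves the homogeneous scheme. *)

theory Defs
  imports "HOL-Analysis.Analysis" "HOL-Computational_Algebra.Polynomial"
begin

definition freq :: "nat \<Rightarrow> real" where
  "freq i = 2 * pi * real i"

definition sin_coeff1 :: "(real \<Rightarrow> real) \<Rightarrow> nat \<Rightarrow> real" where
  "sin_coeff1 f i = integral {0..1} (\<lambda>x. f x * sin (freq i * x))"

definition total_mass :: "(real \<Rightarrow> real \<Rightarrow> real) \<Rightarrow> real \<Rightarrow> real" where
  "total_mass h t = integral {0..1} (\<lambda>x. h x t)"

definition mittag_leffler :: "real \<Rightarrow> real \<Rightarrow> real \<Rightarrow> real" where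
  "mittag_leffler \<alpha> \<beta> z = (\<Sum>k. z ^ k / Gamma (\<alpha> * real k + \<beta>))"

(* As 0 powr a = 0 for every a, Theta has the value 0 at t = 0. This is harmless:
   it is used for t > 0, and under the integral sign the point t = 0 is negligible. *)
definition Theta :: "real \<Rightarrow> real \<Rightarrow> nat \<Rightarrow> real \<Rightarrow> real" where
  "Theta \<alpha> \<mu> i t = t powr (\<mu> - 1) * mittag_leffler \<alpha> \<mu> (- ((freq i)\<^sup>2 * t powr \<alpha>))"


definition rl_integral :: "real \<Rightarrow> (real \<Rightarrow> real) \<Rightarrow> real \<Rightarrow> real" where
  "rl_integral \<mu> y t =
     (if \<mu> = 0 then y t
      else integral {0..t} (\<lambda>\<tau>. (t - \<tau>) powr (\<mu> - 1) / Gamma \<mu> * y \<tau>))"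

definition rl_integrable :: "real \<Rightarrow> (real \<Rightarrow> real) \<Rightarrow> real \<Rightarrow> bool" where
  "rl_integrable \<mu> y t \<longleftrightarrow>
     \<mu> = 0 \<or> (\<lambda>\<tau>. (t - \<tau>) powr (\<mu> - 1) / Gamma \<mu> * y \<tau>) absolutely_integrable_on {0..t}"

(* The value of the fractional integral at 0 is its limit from the right: for \<mu> > 0 the
   integral over {0..0} is 0 even for functions such as y(t) = t powr (- \<mu>), whose
   fractional integral is a nonzero constant for t > 0. *)
definition rl_initial :: "real \<Rightarrow> (real \<Rightarrow> real) \<Rightarrow> real" where
  "rl_initial \<mu> y = (if \<mu> = 0 then y 0 else Lim (at_right 0) (rl_integral \<mu> y))"

(* Functions of time are given on {0..T}, hence the one-sided derivative at T. *)
definition rl_deriv :: "real \<Rightarrow> real \<Rightarrow> (real \<Rightarrow> real) \<Rightarrow> real \<Rightarrow> real" where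
  "rl_deriv T \<mu> y t = vector_derivative (rl_integral (1 - \<mu>) y) (at t within {0..T})"

definition rl_correct :: "real \<Rightarrow> (real \<Rightarrow> real) \<Rightarrow> real \<Rightarrow> real" where
  "rl_correct \<gamma> y t = y t - rl_initial (1 - \<gamma>) y / Gamma \<gamma> * t powr (\<gamma> - 1)"

definition gen_deriv :: "real \<Rightarrow> real \<Rightarrow> real \<Rightarrow> (real \<Rightarrow> real) \<Rightarrow> real \<Rightarrow> real" where
  "gen_deriv T \<alpha> \<gamma> y t = rl_deriv T \<alpha> (rl_correct \<gamma> y) t"

(* All the integrals, limits and derivatives entering gen_deriv exist on (0, T]. *)
definition gen_deriv_exists :: "real \<Rightarrow> real \<Rightarrow> real \<Rightarrow> (real \<Rightarrow> real) \<Rightarrow> bool" where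
  "gen_deriv_exists T \<alpha> \<gamma> y \<longleftrightarrow>
     (\<forall>t\<in>{0<..T}. rl_integrable (1 - \<gamma>) y t) \<and>
     (\<gamma> = 1 \<or> (\<exists>l. (rl_integral (1 - \<gamma>) y \<longlongrightarrow> l) (at_right 0))) \<and>
     (\<forall>t\<in>{0<..T}. rl_integrable (1 - \<alpha>) (rl_correct \<gamma> y) t) \<and>
     (\<forall>t\<in>{0<..T}. rl_integral (1 - \<alpha>) (rl_correct \<gamma> y) differentiable (at t within {0..T}))"


definition kernel :: "real \<Rightarrow> (real \<Rightarrow> real \<Rightarrow> real) \<Rightarrow> real \<Rightarrow> real \<Rightarrow> real" where
  "kernel \<alpha> h t \<tau> =
     4 * (\<Sum>i. freq (Suc i) * sin_coeff1 (\<lambda>x. h x \<tau>) (Suc i) * Theta \<alpha> \<alpha> (Suc i) (t - \<tau>))"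

definition kernel_reg_term ::
    "real \<Rightarrow> (real \<Rightarrow> real \<Rightarrow> real) \<Rightarrow> real \<Rightarrow> real \<Rightarrow> nat \<Rightarrow> real" where
  "kernel_reg_term \<alpha> h t \<tau> i =
     freq i * sin_coeff1 (\<lambda>x. h x \<tau>) i *
       mittag_leffler \<alpha> \<alpha> (- ((freq i)\<^sup>2 * (t - \<tau>) powr \<alpha>))"

definition kernel_reg :: "real \<Rightarrow> (real \<Rightarrow> real \<Rightarrow> real) \<Rightarrow> real \<Rightarrow> real \<Rightarrow> real" where
  "kernel_reg \<alpha> h t \<tau> = 4 * (\<Sum>i. kernel_reg_term \<alpha> h t \<tau> (Suc i))"

definition rhs_term :: "real \<Rightarrow> real \<Rightarrow> (real \<Rightarrow> real) \<Rightarrow> real \<Rightarrow> nat \<Rightarrow> real" where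
  "rhs_term \<alpha> \<gamma> g t i = freq i * sin_coeff1 g i * Theta \<alpha> \<gamma> i t"

definition rhs ::
    "real \<Rightarrow> real \<Rightarrow> real \<Rightarrow> (real \<Rightarrow> real) \<Rightarrow> (real \<Rightarrow> real) \<Rightarrow> real \<Rightarrow> real" where
  "rhs T \<alpha> \<gamma> g q t = gen_deriv T \<alpha> \<gamma> q t + 4 * (\<Sum>i. rhs_term \<alpha> \<gamma> g t (Suc i))"


definition mesh :: "real \<Rightarrow> real \<Rightarrow> nat \<Rightarrow> nat \<Rightarrow> real" where
  "mesh T \<delta> N n = (real n / real N) powr \<delta> * T"

definition mesh_step :: "real \<Rightarrow> real \<Rightarrow> nat \<Rightarrow> nat \<Rightarrow> real" where
  "mesh_step T \<delta> N n = mesh T \<delta> N n - mesh T \<delta> N (n - 1)"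

definition mesh_size :: "real \<Rightarrow> real \<Rightarrow> nat \<Rightarrow> real" where
  "mesh_size T \<delta> N = Max (mesh_step T \<delta> N ` {1..N})"

definition coll_pt :: "real \<Rightarrow> real \<Rightarrow> nat \<Rightarrow> (nat \<Rightarrow> real) \<Rightarrow> nat \<Rightarrow> nat \<Rightarrow> real" where
  "coll_pt T \<delta> N \<xi> n j = mesh T \<delta> N (n - 1) + \<xi> j * mesh_step T \<delta> N n"

(* Functions on (0, T], the union of the mesh intervals; outside they are undefined, so that
   equality in the space is equality on (0, T]. *)
definition pw_linear_space :: "real \<Rightarrow> real \<Rightarrow> nat \<Rightarrow> (real \<Rightarrow> real) set" where
  "pw_linear_space T \<delta> N =
     {w \<in> extensional {0<..T}.
        \<forall>n\<in>{1..N}. \<exists>p::real poly. degree p \<le> 1 \<and>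
          (\<forall>t\<in>{mesh T \<delta> N (n - 1)<..mesh T \<delta> N n}. w t = poly p t)}"

definition lagrange_basis ::
    "real \<Rightarrow> real \<Rightarrow> nat \<Rightarrow> (nat \<Rightarrow> real) \<Rightarrow> nat \<Rightarrow> nat \<Rightarrow> real \<Rightarrow> real" where
  "lagrange_basis T \<delta> N \<xi> n s t =
     (if s = 1
      then (coll_pt T \<delta> N \<xi> n 2 - t) / (coll_pt T \<delta> N \<xi> n 2 - coll_pt T \<delta> N \<xi> n 1)
      else (t - coll_pt T \<delta> N \<xi> n 1) / (coll_pt T \<delta> N \<xi> n 2 - coll_pt T \<delta> N \<xi> n 1))"

(* a_{n,s}(t_{n,j}) *)
definition coll_weight ::
    "real \<Rightarrow> (real \<Rightarrow> real \<Rightarrow> real) \<Rightarrow> real \<Rightarrow> real \<Rightarrow> nat \<Rightarrow> (nat \<Rightarrow> real) \<Rightarrow>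
      nat \<Rightarrow> nat \<Rightarrow> nat \<Rightarrow> real" where
  "coll_weight \<alpha> h T \<delta> N \<xi> n s j =
     integral {mesh T \<delta> N (n - 1)..coll_pt T \<delta> N \<xi> n j}
       (\<lambda>\<tau>. kernel \<alpha> h (coll_pt T \<delta> N \<xi> n j) \<tau> * lagrange_basis T \<delta> N \<xi> n s \<tau>)"

definition H_matrix ::
    "(real \<Rightarrow> real \<Rightarrow> real) \<Rightarrow> real \<Rightarrow> real \<Rightarrow> nat \<Rightarrow> (nat \<Rightarrow> real) \<Rightarrow> nat \<Rightarrow> real^2^2" where
  "H_matrix h T \<delta> N \<xi> n =
     vector [vector [total_mass h (coll_pt T \<delta> N \<xi> n 1), 0],
             vector [0, total_mass h (coll_pt T \<delta> N \<xi> n 2)]]"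

definition B_matrix ::
    "real \<Rightarrow> (real \<Rightarrow> real \<Rightarrow> real) \<Rightarrow> real \<Rightarrow> real \<Rightarrow> nat \<Rightarrow> (nat \<Rightarrow> real) \<Rightarrow> nat \<Rightarrow> real^2^2" where
  "B_matrix \<alpha> h T \<delta> N \<xi> n =
     vector [vector [coll_weight \<alpha> h T \<delta> N \<xi> n 1 1, coll_weight \<alpha> h T \<delta> N \<xi> n 2 1],
             vector [coll_weight \<alpha> h T \<delta> N \<xi> n 1 2, coll_weight \<alpha> h T \<delta> N \<xi> n 2 2]]"

(* The bound \<mu> on the inverses is what makes a threshold for the mesh size that does not
   depend on N possible. Mere invertibility for every N and n is not enough: if
   total_mass h t = integral {0..t} (kernel \<alpha> h t), e.g. for
   h x t = H t + 2 * sin (2 * pi * x) with H the integral of the kernel (which depends only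
   on the sine part of h), then H t > 0 for t > 0, while w = 1 solves the homogeneous
   scheme on every mesh. *)
definition H_matrices_bounded_inverse ::
    "(real \<Rightarrow> real \<Rightarrow> real) \<Rightarrow> real \<Rightarrow> real \<Rightarrow> nat \<Rightarrow> (nat \<Rightarrow> real) \<Rightarrow> real \<Rightarrow> bool" where
  "H_matrices_bounded_inverse h T \<delta> N \<xi> \<mu> \<longleftrightarrow>
     (\<forall>n\<in>{1..N}. onorm (\<lambda>v. matrix_inv (H_matrix h T \<delta> N \<xi> n) *v v) \<le> \<mu>)"

definition collocation_solution ::
    "real \<Rightarrow> real \<Rightarrow> (real \<Rightarrow> real \<Rightarrow> real) \<Rightarrow> (real \<Rightarrow> real) \<Rightarrow> (real \<Rightarrow> real) \<Rightarrow>
      real \<Rightarrow> real \<Rightarrow> nat \<Rightarrow> (nat \<Rightarrow> real) \<Rightarrow> (real \<Rightarrow> real) \<Rightarrow> bool" where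
  "collocation_solution \<alpha> \<gamma> h g q T \<delta> N \<xi> w \<longleftrightarrow>
     w \<in> pw_linear_space T \<delta> N \<and>
     (\<forall>n\<in>{1..N}. \<forall>j\<in>{1,2}.
        (let t = coll_pt T \<delta> N \<xi> n j in
           total_mass h t * w t - integral {0..t} (\<lambda>\<tau>. kernel \<alpha> h t \<tau> * w \<tau>)
             = rhs T \<alpha> \<gamma> g q t))"

end

theory Submission
  imports Defs
begin

text \<open>
  The kernel is \<open>(t - \<tau>) powr (\<alpha> - 1)\<close> times a bounded continuous factor, and this singularity is
  integrable because \<open>\<alpha> > 0\<close>: its integral over an interval of length \<open>s\<close> ending at \<open>t\<close> is
  \<open>s powr \<alpha> / \<alpha>\<close>. The Lagrange basis functions are bounded by \<open>1 / (\<xi> 2 - \<xi> 1)\<close> on their mesh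
  interval, whatever its length. Hence every entry of \<open>B\<close> on a mesh interval is at most a constant
  times the \<open>\<alpha>\<close>-th power of its length (\<open>weight_bound\<close>), with a constant independent of the mesh.
  As the inverse of \<open>H\<close> is bounded by \<open>\<mu>\<close>, the norm of \<open>H\<^sup>-\<^sup>1 B\<close> is below 1 once the mesh is fine, and
  then \<open>H v = B v\<close> forces \<open>v = 0\<close>, so \<open>H - B\<close> is invertible (\<open>invertible_diff_if_onorm_less\<close>).

  The scheme is of Volterra type: the equations at the two collocation points of a mesh interval
  involve only the values of the unknown up to that interval. With the earlier values known, they
  are a linear system with matrix \<open>H - B\<close> for the two values at the collocation points
  (\<open>collocates_iff_linear_system\<close>), and two values determine a linear polynomial. Solving from left
  to right, one interval at a time, gives existence (\<open>scheme_upto_extend\<close>) and uniqueness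
  (\<open>scheme_upto_unique\<close>).
\<close>

section \<open>Perturbing an invertible matrix\<close>

lemma matrix_inv_inverse:
  fixes A :: "real^'n^'n"
  assumes "invertible A"
  shows "A ** matrix_inv A = mat 1" "matrix_inv A ** A = mat 1"
  using someI_ex[OF assms[unfolded invertible_def]] unfolding matrix_inv_def by auto

text \<open>A kernel vector of \<open>A - B\<close> is a fixed point of \<open>A\<^sup>-\<^sup>1 B\<close>, which is a strict contraction.\<close>

lemma invertible_diff_if_onorm_less:
  fixes A B :: "real^'n^'n"
  assumes inv: "invertible A"
    and A: "onorm (\<lambda>v. matrix_inv A *v v) \<le> \<mu>" and B: "onorm (\<lambda>v. B *v v) \<le> b"
    and less: "\<mu> * b < 1"
  shows "invertible (A - B)"
  unfolding invertible_left_inverse matrix_left_invertible_ker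
proof (intro allI impI)
  fix v assume "(A - B) *v v = 0"
  then have "A *v v = B *v v" by (simp add: matrix_vector_mult_diff_rdistrib)
  then have v: "v = matrix_inv A *v (B *v v)"
    using inv by (metis matrix_inv_inverse(2) matrix_vector_mul_assoc matrix_vector_mul_lid)
  have lin: "bounded_linear (\<lambda>v. C *v v)" for C :: "real^'n^'n"
    by (simp add: linear_conv_bounded_linear[symmetric])
  have "0 \<le> \<mu>" using onorm_pos_le[OF lin, of "matrix_inv A"] A by linarith
  have "norm v \<le> \<mu> * norm (B *v v)"
    using onorm[OF lin, of "matrix_inv A" "B *v v"] mult_right_mono[OF A, of "norm (B *v v)"] v
    by fastforce
  also have "\<dots> \<le> \<mu> * (b * norm v)"
    using onorm[OF lin, of B v] mult_right_mono[OF B, of "norm v"] \<open>0 \<le> \<mu>\<close>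
    by (intro mult_left_mono) auto
  finally have "norm v * (1 - \<mu> * b) \<le> 0" by (simp add: algebra_simps)
  then show "v = 0" using less by (simp add: mult_le_0_iff)
qed

lemma invertible_ex1_solution:
  fixes A :: "real^'n^'n"
  assumes "invertible A"
  shows "\<exists>!u. A *v u = b"
  using assms by (metis matrix_inv_inverse matrix_vector_mul_assoc matrix_vector_mul_lid)


section \<open>Weakly singular integrals\<close>

lemma has_integral_weak_singularity:
  fixes a t \<alpha> :: real
  assumes "0 < \<alpha>" "a \<le> t"
  shows "((\<lambda>\<tau>. (t - \<tau>) powr (\<alpha> - 1)) has_integral ((t - a) powr \<alpha> / \<alpha>)) {a..t}"
proof -
  have "((\<lambda>\<tau>. (t - \<tau>) powr (\<alpha> - 1)) has_integral
      (- ((t - t) powr \<alpha> / \<alpha>) - - ((t - a) powr \<alpha> / \<alpha>))) {a..t}"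
    using assms
    by (intro fundamental_theorem_of_calculus_interior)
       (auto intro!: derivative_eq_intros continuous_intros continuous_on_powr'
             simp flip: has_real_derivative_iff_has_vector_derivative)
  then show ?thesis using assms by simp
qed

text \<open>For \<open>\<alpha> < 1\<close> the integrand is unbounded when \<open>b = t\<close>; it is nevertheless the product of an
  absolutely integrable function and a bounded measurable one.\<close>

lemma weakly_singular_integrable:
  fixes a b t \<alpha> :: real
  assumes "0 < \<alpha>" "a \<le> b" "b \<le> t" and f: "continuous_on {a..b} f"
  shows "(\<lambda>\<tau>. (t - \<tau>) powr (\<alpha> - 1) * f \<tau>) integrable_on {a..b}"
proof -
  have "(\<lambda>\<tau>. (t - \<tau>) powr (\<alpha> - 1)) integrable_on {a..t}"
    using has_integral_weak_singularity assms by (meson has_integral_integrable order.trans)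
  then have "(\<lambda>\<tau>. (t - \<tau>) powr (\<alpha> - 1)) integrable_on {a..b}"
    by (rule integrable_subinterval_real) (use assms in auto)
  then have "(\<lambda>\<tau>. (t - \<tau>) powr (\<alpha> - 1)) absolutely_integrable_on {a..b}"
    by (rule nonnegative_absolutely_integrable_1) auto
  moreover have "bounded (f ` {a..b})"
    using compact_continuous_image[OF f] compact_imp_bounded by auto
  ultimately have "(\<lambda>\<tau>. f \<tau> * (t - \<tau>) powr (\<alpha> - 1)) absolutely_integrable_on {a..b}"
    using f by (intro absolutely_integrable_bounded_measurable_product_real
        continuous_imp_measurable_on_sets_lebesgue) auto
  then show ?thesis
    using set_lebesgue_integral_eq_integral(1) by (simp add: mult.commute)
qed

lemma weakly_singular_integral_bound:
  fixes a t \<alpha> :: real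
  assumes "0 < \<alpha>" "a \<le> t" and f: "continuous_on {a..t} f"
    and bound: "\<And>\<tau>. \<tau> \<in> {a..t} \<Longrightarrow> \<bar>f \<tau>\<bar> \<le> M"
  shows "\<bar>integral {a..t} (\<lambda>\<tau>. (t - \<tau>) powr (\<alpha> - 1) * f \<tau>)\<bar> \<le> M / \<alpha> * (t - a) powr \<alpha>"
proof -
  note int = has_integral_mult_left[OF has_integral_weak_singularity[OF assms(1,2)], of M]
  have "norm (integral {a..t} (\<lambda>\<tau>. (t - \<tau>) powr (\<alpha> - 1) * f \<tau>))
      \<le> integral {a..t} (\<lambda>\<tau>. (t - \<tau>) powr (\<alpha> - 1) * M)"
    using assms int
    by (intro integral_norm_bound_integral weakly_singular_integrable has_integral_integrable)
       (auto simp: abs_mult mult_left_mono)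
  then show ?thesis using integral_unique[OF int] by (simp add: mult.commute)
qed

text \<open>The mesh intervals are open on the left while integrals run over closed intervals, so the
  integrand is only under control away from the left end point.\<close>

lemma integral_spike_left_end:
  fixes f g :: "real \<Rightarrow> real"
  assumes eq: "\<And>\<tau>. \<tau> \<in> {a<..b} \<Longrightarrow> f \<tau> = g \<tau>"
  shows "integral {a..b} f = integral {a..b} g"
    and "f integrable_on {a..b} \<longleftrightarrow> g integrable_on {a..b}"
proof -
  have neg: "negligible {a}" by simp
  have eq1: "g \<tau> = f \<tau>" if "\<tau> \<in> {a..b} - {a}" for \<tau> using that eq by simp
  have eq2: "f \<tau> = g \<tau>" if "\<tau> \<in> {a..b} - {a}" for \<tau> using that eq by simp
  show "integral {a..b} f = integral {a..b} g"
    by (rule integral_spike[OF neg eq1])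
  show "f integrable_on {a..b} \<longleftrightarrow> g integrable_on {a..b}"
    by (rule iffI; erule integrable_spike[OF _ neg]) (simp_all add: eq)
qed


section \<open>Linear interpolation\<close>

lemma linear_poly_eqI:
  fixes p q :: "real poly"
  assumes "degree p \<le> 1" "degree q \<le> 1" "x \<noteq> y"
    and "poly p x = poly q x" "poly p y = poly q y"
  shows "p = q"
proof (rule ccontr)
  assume "p \<noteq> q"
  then have nz: "p - q \<noteq> 0" by simp
  have "{x, y} \<subseteq> {z. poly (p - q) z = 0}" using assms by auto
  then have "card {x, y} \<le> card {z. poly (p - q) z = 0}"
    by (intro card_mono poly_roots_finite nz)
  also have "\<dots> \<le> degree (p - q)" by (rule card_poly_roots_bound[OF nz])
  also have "\<dots> \<le> 1" using assms degree_diff_le by blast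
  finally show False using assms by simp
qed

lemma linear_poly_interpolate:
  fixes x y a b :: real
  assumes "x \<noteq> y"
  obtains p where "degree p \<le> 1" "poly p x = a" "poly p y = b"
proof
  show "degree [:(a * y - b * x) / (y - x), (b - a) / (y - x):] \<le> 1" by simp
  show "poly [:(a * y - b * x) / (y - x), (b - a) / (y - x):] x = a"
    "poly [:(a * y - b * x) / (y - x), (b - a) / (y - x):] y = b"
    using assms by (simp_all add: divide_simps) (simp_all add: algebra_simps)
qed

lemma linear_poly_lagrange:
  fixes p :: "real poly"
  assumes "degree p \<le> 1" "x \<noteq> y"
  shows "poly p t = (y - t) / (y - x) * poly p x + (t - x) / (y - x) * poly p y"
proof -
  obtain c d where "p = [:c, d:]"
    using assms(1) by (metis degree_pCons_eq_if degree_eq_zeroE le_Suc_eq One_nat_def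
        le_zero_eq pCons_cases nat.inject nat.distinct(1) pCons_0_0)
  then show ?thesis using assms(2) by (simp add: divide_simps) (simp add: algebra_simps)
qed


section \<open>The graded mesh and the collocation weights\<close>

text \<open>The locale fixes \<open>N\<close>. The mesh-size threshold must not depend on it, so the bound \<open>M\<close> of the
  regular factor of the kernel, from which the threshold is built, is a parameter of the lemmas.\<close>

locale graded_collocation =
  fixes T \<alpha> \<delta> :: real and h :: "real \<Rightarrow> real \<Rightarrow> real" and \<xi> :: "nat \<Rightarrow> real" and N :: nat
  assumes T: "0 < T" and \<alpha>: "0 < \<alpha>" and \<delta>: "1 \<le> \<delta>"
    and \<xi>: "0 < \<xi> 1" "\<xi> 1 < \<xi> 2" "\<xi> 2 < 1" and N: "1 \<le> N"
    and kernel_series: "\<And>t \<tau>. 0 \<le> \<tau> \<Longrightarrow> \<tau> \<le> t \<Longrightarrow> t \<le> T \<Longrightarrow>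
          summable (\<lambda>i. kernel_reg_term \<alpha> h t \<tau> (Suc i))"
    and kernel_continuous:
      "continuous_on {(t, \<tau>). 0 \<le> \<tau> \<and> \<tau> \<le> t \<and> t \<le> T} (\<lambda>(t, \<tau>). kernel_reg \<alpha> h t \<tau>)"
begin

abbreviation node :: "nat \<Rightarrow> real" where "node \<equiv> mesh T \<delta> N"
abbreviation step :: "nat \<Rightarrow> real" where "step \<equiv> mesh_step T \<delta> N"
abbreviation cpt :: "nat \<Rightarrow> nat \<Rightarrow> real" where "cpt \<equiv> coll_pt T \<delta> N \<xi>"
abbreviation weight :: "nat \<Rightarrow> nat \<Rightarrow> nat \<Rightarrow> real" where "weight \<equiv> coll_weight \<alpha> h T \<delta> N \<xi>"

lemma node_0 [simp]: "node 0 = 0" by (simp add: mesh_def)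

lemma node_N [simp]: "node N = T" using N by (simp add: mesh_def)

lemma node_mono: "m \<le> n \<Longrightarrow> node m \<le> node n"
  unfolding mesh_def using T \<delta>
  by (intro mult_right_mono powr_mono2 divide_right_mono) auto

lemma node_nonneg: "0 \<le> node n" using node_mono[of 0 n] by simp

lemma node_le_T: "n \<le> N \<Longrightarrow> node n \<le> T" using node_mono[of n N] by simp

lemma step_pos: "n \<in> {1..N} \<Longrightarrow> 0 < step n"
  unfolding mesh_step_def mesh_def using T \<delta> N
  by (auto intro!: mult_strict_right_mono powr_less_mono2 divide_strict_right_mono)

lemma step_le_mesh_size: "n \<in> {1..N} \<Longrightarrow> step n \<le> mesh_size T \<delta> N"
  unfolding mesh_size_def by (intro Max_ge) auto

lemma cpt_bounds:
  assumes "n \<in> {1..N}" "j \<in> {1, 2}"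
  shows "node (n - 1) < cpt n j" "cpt n j < node n" "0 < cpt n j" "cpt n j < T"
proof -
  have \<xi>j: "0 < \<xi> j" "\<xi> j < 1" using assms(2) \<xi> by auto
  show l: "node (n - 1) < cpt n j" and u: "cpt n j < node n"
    using mult_pos_pos[OF \<xi>j(1) step_pos[OF assms(1)]]
      mult_strict_right_mono[OF \<xi>j(2) step_pos[OF assms(1)]] mesh_step_def[of T \<delta> N n]
    unfolding coll_pt_def by linarith+
  show "0 < cpt n j" using l node_nonneg[of "n - 1"] by linarith
  show "cpt n j < T" using u node_le_T[of n] assms(1) by auto
qed

lemma cpt_diff: "cpt n 2 - cpt n 1 = (\<xi> 2 - \<xi> 1) * step n"
  by (simp add: coll_pt_def algebra_simps)

lemma cpt_less: "n \<in> {1..N} \<Longrightarrow> cpt n 1 < cpt n 2"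
  using cpt_diff[of n] step_pos[of n] \<xi> mult_pos_pos[of "\<xi> 2 - \<xi> 1" "step n"] by linarith

text \<open>At \<open>\<tau> = t\<close> both sides are 0, because \<open>0 powr a = 0\<close> for every \<open>a\<close>.\<close>

lemma kernel_eq:
  assumes "0 \<le> \<tau>" "\<tau> \<le> t" "t \<le> T"
  shows "kernel \<alpha> h t \<tau> = (t - \<tau>) powr (\<alpha> - 1) * kernel_reg \<alpha> h t \<tau>"
  using suminf_mult[OF kernel_series[OF assms], of "(t - \<tau>) powr (\<alpha> - 1)"]
  unfolding kernel_def kernel_reg_def
  by (simp add: kernel_reg_term_def Theta_def mult_ac)

lemma kernel_reg_continuous:
  assumes "0 \<le> a" "b \<le> t" "t \<le> T"
  shows "continuous_on {a..b} (kernel_reg \<alpha> h t)"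
proof -
  have "continuous_on {a..b} (\<lambda>\<tau>. (\<lambda>(t, \<tau>). kernel_reg \<alpha> h t \<tau>) (t, \<tau>))"
    by (rule continuous_on_compose2[OF kernel_continuous])
       (use assms in \<open>auto intro!: continuous_intros\<close>)
  then show ?thesis by simp
qed

lemma kernel_integrable:
  assumes "0 \<le> a" "a \<le> b" "b \<le> t" "t \<le> T" and f: "continuous_on {a..b} f"
  shows "(\<lambda>\<tau>. kernel \<alpha> h t \<tau> * f \<tau>) integrable_on {a..b}"
proof -
  have "(\<lambda>\<tau>. (t - \<tau>) powr (\<alpha> - 1) * (kernel_reg \<alpha> h t \<tau> * f \<tau>)) integrable_on {a..b}"
    using assms \<alpha> kernel_reg_continuous
    by (intro weakly_singular_integrable continuous_on_mult) auto
  then show ?thesis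
    by (rule integrable_eq) (use assms in \<open>auto simp: kernel_eq\<close>)
qed

lemma lagrange_basis_continuous: "continuous_on A (lagrange_basis T \<delta> N \<xi> n s)"
  unfolding lagrange_basis_def divide_inverse
  by (cases "s = 1") (auto intro!: continuous_intros)

text \<open>The distance of the two collocation points is a fixed fraction of the step, so the bound does not
  depend on the mesh.\<close>

lemma lagrange_basis_bound:
  assumes n: "n \<in> {1..N}" and \<tau>: "\<tau> \<in> {node (n - 1)..node n}"
  shows "\<bar>lagrange_basis T \<delta> N \<xi> n s \<tau>\<bar> \<le> 1 / (\<xi> 2 - \<xi> 1)"
proof -
  have "\<bar>cpt n 2 - \<tau>\<bar> \<le> step n" "\<bar>\<tau> - cpt n 1\<bar> \<le> step n"
    using cpt_bounds(1,2)[OF n, of 1] cpt_bounds(1,2)[OF n, of 2] \<tau> by (auto simp: mesh_step_def)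
  then show ?thesis
    unfolding lagrange_basis_def cpt_diff using \<xi> step_pos[OF n]
    by (auto simp: abs_mult divide_simps)
qed

lemma weight_bound:
  assumes n: "n \<in> {1..N}" and j: "j \<in> {1, 2}"
    and M: "\<And>t \<tau>. 0 \<le> \<tau> \<Longrightarrow> \<tau> \<le> t \<Longrightarrow> t \<le> T \<Longrightarrow> \<bar>kernel_reg \<alpha> h t \<tau>\<bar> \<le> M"
  shows "\<bar>weight n s j\<bar> \<le> M / (\<xi> 2 - \<xi> 1) / \<alpha> * step n powr \<alpha>"
proof -
  let ?a = "node (n - 1)" and ?t = "cpt n j" and ?L = "lagrange_basis T \<delta> N \<xi> n s"
  note c = cpt_bounds[OF n j] and a = node_nonneg[of "n - 1"]
  have M0: "0 \<le> M" using M[of 0 0] T abs_ge_zero order_trans by fastforce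
  have eq: "weight n s j = integral {?a..?t} (\<lambda>\<tau>. (?t - \<tau>) powr (\<alpha> - 1) * (kernel_reg \<alpha> h ?t \<tau> * ?L \<tau>))"
    unfolding coll_weight_def
    by (rule integral_cong) (use c a in \<open>auto simp: kernel_eq\<close>)
  have "\<bar>weight n s j\<bar> \<le> (M * (1 / (\<xi> 2 - \<xi> 1))) / \<alpha> * (?t - ?a) powr \<alpha>"
    unfolding eq
  proof (rule weakly_singular_integral_bound)
    show "continuous_on {?a..?t} (\<lambda>\<tau>. kernel_reg \<alpha> h ?t \<tau> * ?L \<tau>)"
      using c a by (intro continuous_on_mult kernel_reg_continuous lagrange_basis_continuous) auto
    fix \<tau> assume \<tau>: "\<tau> \<in> {?a..?t}"
    show "\<bar>kernel_reg \<alpha> h ?t \<tau> * ?L \<tau>\<bar> \<le> M * (1 / (\<xi> 2 - \<xi> 1))"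
      unfolding abs_mult using \<tau> c a M0
      by (intro mult_mono M lagrange_basis_bound[OF n]) auto
  qed (use c \<alpha> in auto)
  also have "\<dots> \<le> M * (1 / (\<xi> 2 - \<xi> 1)) / \<alpha> * step n powr \<alpha>"
  proof (intro mult_left_mono powr_mono2)
    show "?t - ?a \<le> step n" using c by (simp add: mesh_step_def)
  qed (use c \<alpha> \<xi> M0 in simp_all)
  finally show ?thesis by simp
qed

text \<open>The operator norm of a \<open>2 \<times> 2\<close> matrix is at most 4 times its largest absolute entry.\<close>

lemma system_matrix_invertible:
  assumes n: "n \<in> {1..N}"
    and M: "\<And>t \<tau>. 0 \<le> \<tau> \<Longrightarrow> \<tau> \<le> t \<Longrightarrow> t \<le> T \<Longrightarrow> \<bar>kernel_reg \<alpha> h t \<tau>\<bar> \<le> M"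
    and inv: "invertible (H_matrix h T \<delta> N \<xi> n)"
    and \<mu>: "onorm (\<lambda>v. matrix_inv (H_matrix h T \<delta> N \<xi> n) *v v) \<le> \<mu>"
    and less: "\<mu> * (4 * (M / (\<xi> 2 - \<xi> 1) / \<alpha> * step n powr \<alpha>)) < 1"
  shows "invertible (H_matrix h T \<delta> N \<xi> n - B_matrix \<alpha> h T \<delta> N \<xi> n)"
proof (rule invertible_diff_if_onorm_less[OF inv \<mu> _ less])
  have "\<bar>B_matrix \<alpha> h T \<delta> N \<xi> n $ i $ j\<bar> \<le> M / (\<xi> 2 - \<xi> 1) / \<alpha> * step n powr \<alpha>" for i j
    using weight_bound[OF n _ M] exhaust_2[of i] exhaust_2[of j]
    by (auto simp: B_matrix_def)
  from onorm_le_matrix_component[OF this]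
  show "onorm ((*v) (B_matrix \<alpha> h T \<delta> N \<xi> n)) \<le> 4 * (M / (\<xi> 2 - \<xi> 1) / \<alpha> * step n powr \<alpha>)"
    by simp
qed


section \<open>Forward substitution\<close>

definition linear_on_cell :: "nat \<Rightarrow> (real \<Rightarrow> real) \<Rightarrow> bool" where
  "linear_on_cell n w \<longleftrightarrow>
     (\<exists>p. degree p \<le> 1 \<and> (\<forall>t\<in>{node (n - 1)<..node n}. w t = poly p t))"

definition collocates :: "(real \<Rightarrow> real) \<Rightarrow> nat \<Rightarrow> (real \<Rightarrow> real) \<Rightarrow> bool" where
  "collocates r n w \<longleftrightarrow>
     (\<forall>j\<in>{1, 2}. total_mass h (cpt n j) * w (cpt n j)
        - integral {0..cpt n j} (\<lambda>\<tau>. kernel \<alpha> h (cpt n j) \<tau> * w \<tau>) = r (cpt n j))"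

text \<open>The induction over the mesh needs the scheme truncated after \<open>m\<close> intervals, with functions
  undefined beyond them, so that uniqueness can be stated as equality at every stage.\<close>

definition scheme_upto :: "(real \<Rightarrow> real) \<Rightarrow> nat \<Rightarrow> (real \<Rightarrow> real) \<Rightarrow> bool" where
  "scheme_upto r m w \<longleftrightarrow>
     w \<in> extensional {0<..node m} \<and> (\<forall>n\<in>{1..m}. linear_on_cell n w \<and> collocates r n w)"

lemma collocation_solution_iff_scheme_upto:
  "collocation_solution \<alpha> \<gamma> h g q T \<delta> N \<xi> w \<longleftrightarrow> scheme_upto (rhs T \<alpha> \<gamma> g q) N w"
  unfolding collocation_solution_def scheme_upto_def pw_linear_space_def
    linear_on_cell_def collocates_def by (auto simp: Let_def)

lemma linear_on_cell_cong:
  assumes "\<And>t. t \<in> {0<..node n} \<Longrightarrow> w t = w' t"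
  shows "linear_on_cell n w \<longleftrightarrow> linear_on_cell n w'"
proof -
  have "w t = w' t" if "t \<in> {node (n - 1)<..node n}" for t
    using assms[of t] that node_nonneg[of "n - 1"] by auto
  then show ?thesis unfolding linear_on_cell_def by simp
qed

text \<open>Causality: the kernel at a collocation point is integrated over the past only.\<close>

lemma collocates_cong:
  assumes n: "n \<in> {1..N}" and eq: "\<And>t. t \<in> {0<..node n} \<Longrightarrow> w t = w' t"
  shows "collocates r n w \<longleftrightarrow> collocates r n w'"
proof -
  have "w (cpt n j) = w' (cpt n j)"
      "integral {0..cpt n j} (\<lambda>\<tau>. kernel \<alpha> h (cpt n j) \<tau> * w \<tau>)
        = integral {0..cpt n j} (\<lambda>\<tau>. kernel \<alpha> h (cpt n j) \<tau> * w' \<tau>)" if j: "j \<in> {1, 2}" for j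
    using cpt_bounds[OF n j] by (auto intro!: integral_spike_left_end(1) eq)
  then show ?thesis unfolding collocates_def by simp
qed

lemma scheme_upto_restrict:
  assumes "scheme_upto r m w" "k \<le> m" "m \<le> N"
  shows "scheme_upto r k (restrict w {0<..node k})"
proof -
  have "linear_on_cell n (restrict w {0<..node k}) \<and> collocates r n (restrict w {0<..node k})"
    if n: "n \<in> {1..k}" for n
  proof -
    have eq: "restrict w {0<..node k} t = w t" if "t \<in> {0<..node n}" for t
      using that n node_mono[of n k] by simp
    have "n \<in> {1..m}" "n \<in> {1..N}" using assms n by auto
    then have "linear_on_cell n w" "collocates r n w"
      using assms(1) unfolding scheme_upto_def by blast+
    moreover have "linear_on_cell n (restrict w {0<..node k}) \<longleftrightarrow> linear_on_cell n w"
      by (rule linear_on_cell_cong) (rule eq)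
    moreover have "collocates r n (restrict w {0<..node k}) \<longleftrightarrow> collocates r n w"
      by (rule collocates_cong[OF \<open>n \<in> {1..N}\<close>]) (rule eq)
    ultimately show ?thesis by blast
  qed
  then show ?thesis unfolding scheme_upto_def by (blast intro: restrict_extensional)
qed

text \<open>A piecewise linear function may jump at the nodes, so integrability is assembled from the mesh
  intervals.\<close>

lemma kernel_history_integrable:
  assumes "\<And>n. n \<in> {1..m} \<Longrightarrow> linear_on_cell n w" "node m \<le> t" "t \<le> T"
  shows "(\<lambda>\<tau>. kernel \<alpha> h t \<tau> * w \<tau>) integrable_on {0..node m}"
  using assms
proof (induction m)
  case 0
  then show ?case using integrable_on_refl[of _ "0::real"] by simp
next
  case (Suc m)
  have le: "node m \<le> node (Suc m)" by (intro node_mono) simp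
  obtain p where p: "\<And>\<tau>. \<tau> \<in> {node m<..node (Suc m)} \<Longrightarrow> w \<tau> = poly p \<tau>"
    using Suc.prems(1)[of "Suc m"] unfolding linear_on_cell_def by auto
  have "(\<lambda>\<tau>. kernel \<alpha> h t \<tau> * poly p \<tau>) integrable_on {node m..node (Suc m)}"
    using Suc.prems le node_nonneg by (intro kernel_integrable continuous_intros) auto
  then have "(\<lambda>\<tau>. kernel \<alpha> h t \<tau> * w \<tau>) integrable_on {node m..node (Suc m)}"
    using p by (subst integral_spike_left_end(2)) auto
  moreover have "(\<lambda>\<tau>. kernel \<alpha> h t \<tau> * w \<tau>) integrable_on {0..node m}"
    using Suc.prems le by (intro Suc.IH) auto
  ultimately show ?case using le node_nonneg
    by (intro Henstock_Kurzweil_Integration.integrable_combine[of 0 "node m" "node (Suc m)"])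
qed

text \<open>On the current interval the unknown is expanded in the Lagrange basis, which turns its share of
  the integral into a combination of the two unknown values with the collocation weights.\<close>

lemma kernel_integral_split:
  assumes n: "n \<in> {1..N}" and j: "j \<in> {1, 2}"
    and past: "\<And>k. k \<in> {1..n - 1} \<Longrightarrow> linear_on_cell k w"
    and p: "degree p \<le> 1" "\<And>t. t \<in> {node (n - 1)<..node n} \<Longrightarrow> w t = poly p t"
  shows "integral {0..cpt n j} (\<lambda>\<tau>. kernel \<alpha> h (cpt n j) \<tau> * w \<tau>)
    = integral {0..node (n - 1)} (\<lambda>\<tau>. kernel \<alpha> h (cpt n j) \<tau> * w \<tau>)
      + (weight n 1 j * poly p (cpt n 1) + weight n 2 j * poly p (cpt n 2))"
proof -
  let ?t = "cpt n j" and ?a = "node (n - 1)" and ?L = "lagrange_basis T \<delta> N \<xi> n"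
  let ?K = "\<lambda>\<tau>. kernel \<alpha> h ?t \<tau>"
  note c = cpt_bounds[OF n j] and a = node_nonneg[of "n - 1"]
  have L: "(\<lambda>\<tau>. ?K \<tau> * ?L s \<tau>) integrable_on {?a..?t}" for s
    using c a by (intro kernel_integrable lagrange_basis_continuous) auto
  have w: "?K \<tau> * w \<tau> = ?K \<tau> * ?L 1 \<tau> * poly p (cpt n 1) + ?K \<tau> * ?L 2 \<tau> * poly p (cpt n 2)"
    if "\<tau> \<in> {?a<..?t}" for \<tau>
  proof -
    have "w \<tau> = ?L 1 \<tau> * poly p (cpt n 1) + ?L 2 \<tau> * poly p (cpt n 2)"
      using linear_poly_lagrange[OF p(1), of "cpt n 1" "cpt n 2" \<tau>] p(2)[of \<tau>] that c cpt_less[OF n]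
      by (simp add: lagrange_basis_def)
    then show ?thesis by (simp only: distrib_left mult.assoc)
  qed
  have "(\<lambda>\<tau>. ?K \<tau> * w \<tau>) integrable_on {?a..?t}"
    by (subst integral_spike_left_end(2)[OF w]) (assumption, intro integrable_add integrable_on_mult_left L)
  moreover have "(\<lambda>\<tau>. ?K \<tau> * w \<tau>) integrable_on {0..?a}"
    using c by (intro kernel_history_integrable past) auto
  ultimately have "(\<lambda>\<tau>. ?K \<tau> * w \<tau>) integrable_on {0..?t}"
    using c a by (intro Henstock_Kurzweil_Integration.integrable_combine[of 0 ?a ?t]) auto
  then have "integral {0..?t} (\<lambda>\<tau>. ?K \<tau> * w \<tau>)
      = integral {0..?a} (\<lambda>\<tau>. ?K \<tau> * w \<tau>) + integral {?a..?t} (\<lambda>\<tau>. ?K \<tau> * w \<tau>)"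
    using c a by (intro Henstock_Kurzweil_Integration.integral_combine[symmetric]) auto
  also have "integral {?a..?t} (\<lambda>\<tau>. ?K \<tau> * w \<tau>)
      = weight n 1 j * poly p (cpt n 1) + weight n 2 j * poly p (cpt n 2)"
    unfolding coll_weight_def
    by (subst integral_spike_left_end(1)[OF w])
       (simp_all add: Henstock_Kurzweil_Integration.integral_add integrable_on_mult_left L del: One_nat_def)
  finally show ?thesis .
qed

text \<open>The right-hand side of the linear system on interval \<open>n\<close>: only values of \<open>w\<close> up to the left
  node enter.\<close>

definition history_load :: "(real \<Rightarrow> real) \<Rightarrow> nat \<Rightarrow> (real \<Rightarrow> real) \<Rightarrow> nat \<Rightarrow> real" where
  "history_load r n w j =
     r (cpt n j) + integral {0..node (n - 1)} (\<lambda>\<tau>. kernel \<alpha> h (cpt n j) \<tau> * w \<tau>)"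

lemma history_load_cong:
  assumes "\<And>t. t \<in> {0<..node (n - 1)} \<Longrightarrow> w t = w' t"
  shows "history_load r n w = history_load r n w'"
  unfolding history_load_def
  by (intro ext arg_cong2[of _ _ _ _ "(+)"] refl integral_spike_left_end(1)) (simp add: assms)

lemma collocates_iff_linear_system:
  assumes n: "n \<in> {1..N}"
    and past: "\<And>k. k \<in> {1..n - 1} \<Longrightarrow> linear_on_cell k w"
    and p: "degree p \<le> 1" "\<And>t. t \<in> {node (n - 1)<..node n} \<Longrightarrow> w t = poly p t"
  shows "collocates r n w \<longleftrightarrow>
    (H_matrix h T \<delta> N \<xi> n - B_matrix \<alpha> h T \<delta> N \<xi> n) *v vector [poly p (cpt n 1), poly p (cpt n 2)]
      = vector [history_load r n w 1, history_load r n w 2]"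
proof -
  have w: "w (cpt n j) = poly p (cpt n j)" if "j \<in> {1, 2}" for j
    using p(2) cpt_bounds[OF n that] by auto
  show ?thesis
    unfolding collocates_def history_load_def vec_eq_iff forall_2
    using w kernel_integral_split[OF n _ past p]
    by (auto simp: matrix_vector_mult_def sum_2 H_matrix_def B_matrix_def algebra_simps)
qed

lemma scheme_upto_extend:
  assumes n: "Suc m \<in> {1..N}" and w: "scheme_upto r m w"
    and inv: "invertible (H_matrix h T \<delta> N \<xi> (Suc m) - B_matrix \<alpha> h T \<delta> N \<xi> (Suc m))"
  shows "\<exists>w'. scheme_upto r (Suc m) w'"
proof -
  let ?A = "H_matrix h T \<delta> N \<xi> (Suc m) - B_matrix \<alpha> h T \<delta> N \<xi> (Suc m)"
  obtain u where u: "?A *v u = vector [history_load r (Suc m) w 1, history_load r (Suc m) w 2]"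
    using invertible_ex1_solution[OF inv] by blast
  obtain p where p: "degree p \<le> 1" "poly p (cpt (Suc m) 1) = u $ 1" "poly p (cpt (Suc m) 2) = u $ 2"
    using linear_poly_interpolate cpt_less[OF n] by (metis less_irrefl)
  define w' where "w' t = (if t \<in> {node m<..node (Suc m)} then poly p t else w t)" for t
  have old: "w' t = w t" if "t \<in> {0<..node m}" for t using that by (auto simp: w'_def)
  have past: "linear_on_cell k w' \<and> collocates r k w'" if k: "k \<in> {1..m}" for k
  proof -
    have eq: "w' t = w t" if "t \<in> {0<..node k}" for t using that k node_mono[of k m] old by auto
    then show ?thesis
      using w k n linear_on_cell_cong[of k w' w, OF eq] collocates_cong[of k w' w, OF _ eq]
      by (simp add: scheme_upto_def)
  qed
  have "u = vector [poly p (cpt (Suc m) 1), poly p (cpt (Suc m) 2)]"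
    by (simp add: vec_eq_iff forall_2 p del: One_nat_def)
  moreover have "history_load r (Suc m) w' = history_load r (Suc m) w"
    using old by (intro history_load_cong) auto
  ultimately have "collocates r (Suc m) w'"
    using u by (subst collocates_iff_linear_system[OF n _ p(1)]) (auto simp: w'_def past)
  moreover have "linear_on_cell (Suc m) w'" using p(1) by (auto simp: linear_on_cell_def w'_def)
  moreover have "w' \<in> extensional {0<..node (Suc m)}"
    using w node_mono[of m "Suc m"] node_nonneg[of m]
    by (auto simp: scheme_upto_def extensional_def w'_def)
  ultimately have "scheme_upto r (Suc m) w'"
    using past by (auto simp: scheme_upto_def le_Suc_eq)
  then show ?thesis by blast
qed

text \<open>Two solutions agree on the earlier intervals by induction, hence have the same load on the last
  one; invertibility gives equal values at both collocation points, and a linear polynomial is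
  determined by two values.\<close>

lemma scheme_upto_unique:
  assumes "m \<le> N"
    and "\<And>n. n \<in> {1..N} \<Longrightarrow> invertible (H_matrix h T \<delta> N \<xi> n - B_matrix \<alpha> h T \<delta> N \<xi> n)"
    and "scheme_upto r m v" "scheme_upto r m w"
  shows "v = w"
  using assms
proof (induction m arbitrary: v w)
  case 0
  then show ?case by (auto simp: scheme_upto_def extensional_def)
next
  case (Suc m)
  let ?n = "Suc m"
  have n: "?n \<in> {1..N}" using Suc.prems by auto
  have "restrict v {0<..node m} = restrict w {0<..node m}"
    using Suc.prems by (intro Suc.IH scheme_upto_restrict[of r ?n]) auto
  then have old: "v t = w t" if "t \<in> {0<..node m}" for t using that by (metis restrict_apply')
  have "linear_on_cell ?n v" "linear_on_cell ?n w"
    using Suc.prems(3,4) by (simp_all add: scheme_upto_def)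
  then obtain p q where p: "degree p \<le> 1" "\<And>t. t \<in> {node m<..node ?n} \<Longrightarrow> v t = poly p t"
    and q: "degree q \<le> 1" "\<And>t. t \<in> {node m<..node ?n} \<Longrightarrow> w t = poly q t"
    unfolding linear_on_cell_def by auto
  have load: "history_load r ?n v = history_load r ?n w"
    using old by (intro history_load_cong) auto
  let ?A = "H_matrix h T \<delta> N \<xi> ?n - B_matrix \<alpha> h T \<delta> N \<xi> ?n"
  have "?A *v vector [poly p (cpt ?n 1), poly p (cpt ?n 2)]
      = ?A *v vector [poly q (cpt ?n 1), poly q (cpt ?n 2)]"
    using collocates_iff_linear_system[OF n _ p(1), of v r]
      collocates_iff_linear_system[OF n _ q(1), of w r] Suc.prems(3,4) p q load
    by (simp add: scheme_upto_def)
  then have "vector [poly p (cpt ?n 1), poly p (cpt ?n 2)]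
      = (vector [poly q (cpt ?n 1), poly q (cpt ?n 2)] :: real^2)"
    using invertible_ex1_solution[OF Suc.prems(2)[OF n]] by metis
  then have "p = q"
    using cpt_less[OF n]
    by (intro linear_poly_eqI[OF p(1) q(1), of "cpt ?n 1" "cpt ?n 2"])
       (simp_all add: vec_eq_iff forall_2)
  show ?case
  proof
    fix t
    consider "t \<in> {0<..node m}" | "t \<in> {node m<..node ?n}" | "t \<notin> {0<..node ?n}"
      by fastforce
    then show "v t = w t"
    proof cases
      case 3
      then show ?thesis using Suc.prems(3,4) by (auto simp: scheme_upto_def extensional_def)
    qed (use old p q \<open>p = q\<close> in auto)
  qed
qed

lemma scheme_upto_ex1:
  assumes "m \<le> N"
    and inv: "\<And>n. n \<in> {1..N} \<Longrightarrow> invertible (H_matrix h T \<delta> N \<xi> n - B_matrix \<alpha> h T \<delta> N \<xi> n)"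
  shows "\<exists>!w. scheme_upto r m w"
proof -
  have "\<exists>w. scheme_upto r m w" using assms(1)
  proof (induction m)
    case 0
    have "scheme_upto r 0 (\<lambda>_. undefined)" by (simp add: scheme_upto_def)
    then show ?case by blast
  next
    case (Suc m)
    then show ?case using scheme_upto_extend inv by fastforce
  qed
  then show ?thesis using scheme_upto_unique[OF assms] by blast
qed

end


section \<open>The mesh-size threshold\<close>

theorem mainTheorem2:
  fixes T \<alpha> \<gamma> \<delta> :: real and h :: "real \<Rightarrow> real \<Rightarrow> real" and g q :: "real \<Rightarrow> real"
    and \<xi> :: "nat \<Rightarrow> real"
  assumes "0 < T" and "0 < \<alpha>" and "\<alpha> \<le> \<gamma>" and "\<gamma> \<le> 1"
    and "1 \<le> \<delta>" and "0 < \<xi> 1" and "\<xi> 1 < \<xi> 2" and "\<xi> 2 < 1"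
    and h_integrable: "\<And>t. t \<in> {0..T} \<Longrightarrow> (\<lambda>x. h x t) absolutely_integrable_on {0..1}"
    and g_integrable: "g absolutely_integrable_on {0..1}"
    and q_regular: "gen_deriv_exists T \<alpha> \<gamma> q"
    and kernel_series: "\<And>t \<tau>. 0 \<le> \<tau> \<Longrightarrow> \<tau> \<le> t \<Longrightarrow> t \<le> T \<Longrightarrow>
          summable (\<lambda>i. kernel_reg_term \<alpha> h t \<tau> (Suc i))"
    and kernel_bounded: "bounded ((\<lambda>(t, \<tau>). kernel_reg \<alpha> h t \<tau>) ` {(t, \<tau>). 0 \<le> \<tau> \<and> \<tau> \<le> t \<and> t \<le> T})"
    and kernel_continuous:
      "continuous_on {(t, \<tau>). 0 \<le> \<tau> \<and> \<tau> \<le> t \<and> t \<le> T} (\<lambda>(t, \<tau>). kernel_reg \<alpha> h t \<tau>)"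
    and rhs_series: "\<And>t. t \<in> {0<..T} \<Longrightarrow> summable (\<lambda>i. rhs_term \<alpha> \<gamma> g t (Suc i))"
    and rhs_continuous: "\<And>\<epsilon>. 0 < \<epsilon> \<Longrightarrow> \<epsilon> < T \<Longrightarrow> continuous_on {\<epsilon>..T} (rhs T \<alpha> \<gamma> g q)"
  shows "\<forall>\<mu>. \<exists>k>0. \<forall>N\<ge>1.
           mesh_size T \<delta> N < k \<longrightarrow>
           (\<forall>n\<in>{1..N}. invertible (H_matrix h T \<delta> N \<xi> n)) \<longrightarrow>
           H_matrices_bounded_inverse h T \<delta> N \<xi> \<mu> \<longrightarrow>
             (\<forall>n\<in>{1..N}. invertible (H_matrix h T \<delta> N \<xi> n - B_matrix \<alpha> h T \<delta> N \<xi> n)) \<and>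
             (\<exists>!w. collocation_solution \<alpha> \<gamma> h g q T \<delta> N \<xi> w)"
proof
  fix \<mu> :: real
  obtain M where M0: "0 < M" and M: "\<And>t \<tau>. 0 \<le> \<tau> \<Longrightarrow> \<tau> \<le> t \<Longrightarrow> t \<le> T \<Longrightarrow> \<bar>kernel_reg \<alpha> h t \<tau>\<bar> \<le> M"
    using kernel_bounded unfolding bounded_pos by fastforce
  define C where "C = 4 * (M / (\<xi> 2 - \<xi> 1) / \<alpha>)"
  \<comment> \<open>Chosen so that \<open>\<bar>\<mu>\<bar> * C * k powr \<alpha> < 1\<close>; adding 1 to \<open>\<bar>\<mu>\<bar>\<close> avoids dividing by 0.\<close>
  define k where "k = (1 / (C * (\<bar>\<mu>\<bar> + 1))) powr (1 / \<alpha>)"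
  have C: "0 < C" using M0 assms by (simp add: C_def)
  have small: "\<mu> * (C * s powr \<alpha>) < 1" if "0 < s" "s < k" for s
  proof -
    have "s powr \<alpha> < k powr \<alpha>" using that assms by (intro powr_less_mono2) auto
    also have "\<dots> = 1 / (C * (\<bar>\<mu>\<bar> + 1))" using C assms by (simp add: k_def powr_powr)
    finally have "C * (\<bar>\<mu>\<bar> + 1) * s powr \<alpha> < 1" using C
      by (simp add: pos_less_divide_eq add_pos_nonneg mult.commute)
    moreover have "\<mu> * (C * s powr \<alpha>) \<le> (\<bar>\<mu>\<bar> + 1) * (C * s powr \<alpha>)"
      using C by (intro mult_right_mono) auto
    ultimately show ?thesis by (simp add: mult_ac)
  qed
  show "\<exists>k>0. \<forall>N\<ge>1.
           mesh_size T \<delta> N < k \<longrightarrow>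
           (\<forall>n\<in>{1..N}. invertible (H_matrix h T \<delta> N \<xi> n)) \<longrightarrow>
           H_matrices_bounded_inverse h T \<delta> N \<xi> \<mu> \<longrightarrow>
             (\<forall>n\<in>{1..N}. invertible (H_matrix h T \<delta> N \<xi> n - B_matrix \<alpha> h T \<delta> N \<xi> n)) \<and>
             (\<exists>!w. collocation_solution \<alpha> \<gamma> h g q T \<delta> N \<xi> w)"
  proof (intro exI[of _ k] conjI allI impI)
    have "C * (\<bar>\<mu>\<bar> + 1) > 0" using C by (intro mult_pos_pos) auto
    then have "0 < 1 / (C * (\<bar>\<mu>\<bar> + 1))" by (simp only: zero_less_divide_1_iff)
    then show "0 < k" unfolding k_def by (metis powr_gt_zero less_irrefl)
    fix N assume N: "1 \<le> N" and size: "mesh_size T \<delta> N < k"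
      and H: "\<forall>n\<in>{1..N}. invertible (H_matrix h T \<delta> N \<xi> n)"
      and \<mu>: "H_matrices_bounded_inverse h T \<delta> N \<xi> \<mu>"
    interpret graded_collocation T \<alpha> \<delta> h \<xi> N
      by unfold_locales (fact assms N kernel_series kernel_continuous)+
    show inv: "\<forall>n\<in>{1..N}. invertible (H_matrix h T \<delta> N \<xi> n - B_matrix \<alpha> h T \<delta> N \<xi> n)"
    proof
      fix n assume n: "n \<in> {1..N}"
      have "\<mu> * (C * step n powr \<alpha>) < 1"
        using step_pos[OF n] step_le_mesh_size[OF n] size by (intro small) auto
      then show "invertible (H_matrix h T \<delta> N \<xi> n - B_matrix \<alpha> h T \<delta> N \<xi> n)"
        using H \<mu> n M
        by (intro system_matrix_invertible) (auto simp: H_matrices_bounded_inverse_def C_def mult_ac)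
    qed
    show "\<exists>!w. collocation_solution \<alpha> \<gamma> h g q T \<delta> N \<xi> w"
      unfolding collocation_solution_iff_scheme_upto using inv by (intro scheme_upto_ex1) auto
  qed
qed

end
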